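(* Let $1<p_1,\dots,p_m<\infty$, $\frac1p=\frac1{p_1}+\cdots+\frac1{p_m}$, and $0<p\le q<\infty$. Let $\varphi:(0,\infty)\to(0,\infty)$ be essentially non-decreasing with $\lim_{t\to\infty}\varphi(t)/t=0$, and let $\mathscr{B}$ be a basis in $\mathbb{R}^n$. Suppose that $Y_1,\dots,Y_m$ are Banach function spaces over $\mathbb{R}^n$ (with Lebesgue measure) such that $$\mathcal{M}_{\vec Y'}:L^{p_1}(\mathbb{R}^n)\times\cdots\times L^{p_m}(\mathbb{R}^n)\to L^p(\mathbb{R}^n)\quad\text{boundedly}.$$ If $\vec w=(w_1,\dots,w_m)$ and $v$ are weights such that the condition $(A_{\mathscr{B},\gamma,v^q})$ holds for some $\gamma\in(0,1)$ and $$\sup_{B\in\mathscr{B}}\varphi(|B|)\,|B|^{\frac1q-\frac1p}\Big(\frac1{|B|}\int_Bv^q\,dx\Big)^{\frac1q}\prod_{i=1}^m\big\|w_i^{-1}\big\|_{Y_i,B}<\infty,$$ then $\mathcal{M}_{\mathscr{B},\varphi}$ is bounded from $L^{p_1}(w_1^{p_1})\times\cdots\times L^{p_m}(w_m^{p_m})$ to $L^q(v^q)$.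
   Context: A basis $\mathscr{B}$ in $\mathbb{R}^n$ is a collection of open sets in $\mathbb{R}^n$. A weight associated with $\mathscr{B}$ is a nonnegative measurable function $w$ with $w(B)=\int_Bw\,dx<\infty$ for each $B\in\mathscr{B}$; here $v^q$ is a weight associated with $\mathscr{B}$. The maximal operator of the basis is $M_{\mathscr{B}}f(x)=\sup_{B\in\mathscr{B},B\ni x}\frac1{|B|}\int_B|f(y)|dy$. $\varphi$ essentially non-decreasing means that there is a constant $\rho>0$ with $\varphi(s)\le\rho\,\varphi(t)$ whenever $0<s\le t$. The multilinear maximal operator associated with $\varphi$ is $$\mathcal{M}_{\mathscr{B},\varphi}(\vec f)(x)=\sup_{B\in\mathscr{B},B\ni x}\varphi(|B|)\prod_{i=1}^m\frac1{|B|}\int_B|f_i(y)|dy .$$ For a Banach function space $Y$ over $\mathbb{R}^n$, $Y'$ is its associate space, so that $\int_{\mathbb{R}^n}|fg|\,dx\le\|f\|_Y\|g\|_{Y'}$. The $Y$-average of $f$ over a set $B$ of finite positive measure is $\|f\|_{Y,B}=\|\tau_{|B|^{1/n}}(f\mathbf 1_B)\|_Y$, where $\tau_\delta g(x)=g(\delta x)$ for $\delta>0$. Then $$\mathcal{M}_{\vec Y'}(\vec f)(x)=\sup_{B\in\mathscr{B},B\ni x}\prod_{i=1}^m\|f_i\|_{Y_i',B}.$$ Tauberian condition $(A_{\mathscr{B},\gamma,\mu})$, for $\gamma\in(0,1)$ and a weight $\mu$: there is a positive constant $C_{\mathscr{B},\gamma,\mu}$ such that for all measurable sets $E$, $\mu(\{x\in\mathbb{R}^n:M_{\mathscr{B}}(\mathbf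 1_E)(x)>\gamma\})\le C_{\mathscr{B},\gamma,\mu}\,\mu(E)$, where $\mu(E)=\int_E\mu\,dx$. Boundedness of $T$ from $L^{p_1}(w_1^{p_1})\times\cdots\times L^{p_m}(w_m^{p_m})$ to $L^q(v^q)$ means $\big(\int|T(\vec f)|^qv^q\,dx\big)^{1/q}\le C\prod_{i=1}^m\big(\int|f_i|^{p_i}w_i^{p_i}dx\big)^{1/p_i}$ for all $\vec f$, with $C$ independent of $\vec f$. *)

theory Defs
  imports "HOL-Analysis.Analysis"
begin

(* Powers of extended non-negative reals, used only for exponents a > 0. *)
definition epowr :: "ennreal \<Rightarrow> real \<Rightarrow> ennreal" where
  "epowr x a = (if x = \<infinity> then \<infinity> else ennreal (enn2real x powr a))"

abbreviation vol :: "(real ^ 'n) set \<Rightarrow> real" where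
  "vol B \<equiv> measure lebesgue B"

(* The paper divides by |B| and evaluates \<phi> : (0,\<infinity>) \<rightarrow> (0,\<infinity>) at |B|, so members of a basis are
   taken to satisfy 0 < |B| < \<infinity>; for an open set, 0 < |B| means that B is non-empty. *)
definition basis :: "(real ^ 'n) set set \<Rightarrow> bool" where
  "basis \<B> \<longleftrightarrow> (\<forall>B\<in>\<B>. open B \<and> B \<noteq> {} \<and> emeasure lebesgue B < \<infinity>)"

definition weight :: "(real ^ 'n \<Rightarrow> real) \<Rightarrow> bool" where
  "weight w \<longleftrightarrow> w \<in> borel_measurable lebesgue \<and> (\<forall>x. 0 \<le> w x)"

definition wmeasure :: "(real ^ 'n \<Rightarrow> real) \<Rightarrow> (real ^ 'n) set \<Rightarrow> ennreal" where
  "wmeasure w E = (\<integral>\<^sup>+x\<in>E. ennreal (w x) \<partial>lebesgue)"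

definition weight_associated :: "(real ^ 'n) set set \<Rightarrow> (real ^ 'n \<Rightarrow> real) \<Rightarrow> bool" where
  "weight_associated \<B> w \<longleftrightarrow> weight w \<and> (\<forall>B\<in>\<B>. wmeasure w B < \<infinity>)"

definition average :: "(real ^ 'n) set \<Rightarrow> (real ^ 'n \<Rightarrow> real) \<Rightarrow> ennreal" where
  "average B f = (\<integral>\<^sup>+y\<in>B. ennreal \<bar>f y\<bar> \<partial>lebesgue) / ennreal (vol B)"

definition maximal_op ::
  "(real ^ 'n) set set \<Rightarrow> (real ^ 'n \<Rightarrow> real) \<Rightarrow> real ^ 'n \<Rightarrow> ennreal" where
  "maximal_op \<B> f x = (SUP B\<in>{B\<in>\<B>. x \<in> B}. average B f)"

(* Here and below, m-tuples are families indexed by nat, of which only the entries 1, ..., m matter. *)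
definition multilinear_maximal_op ::
  "(real ^ 'n) set set \<Rightarrow> (real \<Rightarrow> real) \<Rightarrow> nat \<Rightarrow> (nat \<Rightarrow> real ^ 'n \<Rightarrow> real) \<Rightarrow> real ^ 'n \<Rightarrow> ennreal" where
  "multilinear_maximal_op \<B> \<phi> m f x =
     (SUP B\<in>{B\<in>\<B>. x \<in> B}. ennreal (\<phi> (vol B)) * (\<Prod>i=1..m. average B (f i)))"

definition essentially_nondecreasing :: "(real \<Rightarrow> real) \<Rightarrow> bool" where
  "essentially_nondecreasing \<phi> \<longleftrightarrow> (\<exists>\<rho>>0. \<forall>s t. 0 < s \<longrightarrow> s \<le> t \<longrightarrow> \<phi> s \<le> \<rho> * \<phi> t)"

definition tauberian ::
  "(real ^ 'n) set set \<Rightarrow> real \<Rightarrow> (real ^ 'n \<Rightarrow> real) \<Rightarrow> bool" where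
  "tauberian \<B> \<gamma> \<mu> \<longleftrightarrow>
     (\<exists>C>0. \<forall>E\<in>sets lebesgue.
        wmeasure \<mu> {x. maximal_op \<B> (indicator E) x > ennreal \<gamma>} \<le> ennreal C * wmeasure \<mu> E)"

(* A Banach function space Y over R^n (Bennett--Sharpley) is represented by its function norm Y,
   i.e. norm f = Y |f| and f belongs to the space iff Y |f| < \<infinity>.
   The value of Y on non-measurable functions is unconstrained and never used. *)
locale banach_function_space =
  fixes Y :: "(real ^ 'n \<Rightarrow> ennreal) \<Rightarrow> ennreal"
  assumes norm_eq_0_iff:
      "f \<in> borel_measurable lebesgue \<Longrightarrow> Y f = 0 \<longleftrightarrow> (AE x in lebesgue. f x = 0)"
    and norm_scale:
      "f \<in> borel_measurable lebesgue \<Longrightarrow> 0 \<le> a \<Longrightarrow> Y (\<lambda>x. ennreal a * f x) = ennreal a * Y f"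
    and norm_triangle:
      "f \<in> borel_measurable lebesgue \<Longrightarrow> g \<in> borel_measurable lebesgue \<Longrightarrow>
       Y (\<lambda>x. f x + g x) \<le> Y f + Y g"
    and norm_mono:
      "f \<in> borel_measurable lebesgue \<Longrightarrow> g \<in> borel_measurable lebesgue \<Longrightarrow>
       (AE x in lebesgue. g x \<le> f x) \<Longrightarrow> Y g \<le> Y f"
    and norm_fatou:
      "(\<And>k. F k \<in> borel_measurable lebesgue) \<Longrightarrow> f \<in> borel_measurable lebesgue \<Longrightarrow>
       (AE x in lebesgue. incseq (\<lambda>k::nat. F k x) \<and> (SUP k. F k x) = f x) \<Longrightarrow>
       Y f = (SUP k. Y (F k))"
    and norm_indicator_finite:
      "E \<in> sets lebesgue \<Longrightarrow> emeasure lebesgue E < \<infinity> \<Longrightarrow> Y (indicator E) < \<infinity>"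
    and norm_local_integrable:
      "E \<in> sets lebesgue \<Longrightarrow> emeasure lebesgue E < \<infinity> \<Longrightarrow>
       \<exists>C>0. \<forall>f\<in>borel_measurable lebesgue. (\<integral>\<^sup>+x\<in>E. f x \<partial>lebesgue) \<le> ennreal C * Y f"

definition associate_space ::
  "((real ^ 'n \<Rightarrow> ennreal) \<Rightarrow> ennreal) \<Rightarrow> (real ^ 'n \<Rightarrow> ennreal) \<Rightarrow> ennreal" where
  "associate_space Y g =
     (SUP f\<in>{f \<in> borel_measurable lebesgue. Y f \<le> 1}. \<integral>\<^sup>+x. f x * g x \<partial>lebesgue)"

definition dilate :: "real \<Rightarrow> (real ^ 'n \<Rightarrow> ennreal) \<Rightarrow> real ^ 'n \<Rightarrow> ennreal" where
  "dilate \<delta> g x = g (\<delta> *\<^sub>R x)"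

(* The argument f is the modulus of the function being averaged. *)
definition Y_average ::
  "((real ^ 'n \<Rightarrow> ennreal) \<Rightarrow> ennreal) \<Rightarrow> (real ^ 'n) set \<Rightarrow> (real ^ 'n \<Rightarrow> ennreal) \<Rightarrow> ennreal" where
  "Y_average Y B f = Y (dilate (vol B powr (1 / real CARD('n))) (\<lambda>x. f x * indicator B x))"

definition associate_maximal_op ::
  "(real ^ 'n) set set \<Rightarrow> (nat \<Rightarrow> (real ^ 'n \<Rightarrow> ennreal) \<Rightarrow> ennreal) \<Rightarrow> nat \<Rightarrow>
   (nat \<Rightarrow> real ^ 'n \<Rightarrow> real) \<Rightarrow> real ^ 'n \<Rightarrow> ennreal" where
  "associate_maximal_op \<B> Y m f x =
     (SUP B\<in>{B\<in>\<B>. x \<in> B}. \<Prod>i=1..m. Y_average (associate_space (Y i)) B (\<lambda>y. ennreal \<bar>f i y\<bar>))"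

(* The (quasi-)norm of L^r(\<mu>), with values in [0,\<infinity>]. *)
definition wLp_norm :: "real \<Rightarrow> (real ^ 'n \<Rightarrow> real) \<Rightarrow> (real ^ 'n \<Rightarrow> ennreal) \<Rightarrow> ennreal" where
  "wLp_norm r \<mu> g = epowr (\<integral>\<^sup>+x. epowr (g x) r * ennreal (\<mu> x) \<partial>lebesgue) (1 / r)"

definition wLp :: "real \<Rightarrow> (real ^ 'n \<Rightarrow> real) \<Rightarrow> (real ^ 'n \<Rightarrow> real) set" where
  "wLp r \<mu> = {f \<in> borel_measurable lebesgue. wLp_norm r \<mu> (\<lambda>x. ennreal \<bar>f x\<bar>) < \<infinity>}"

(* T is bounded from L^{r 1}(\<mu> 1) x ... x L^{r m}(\<mu> m) to L^s(\<nu>). *)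
definition bounded_multi ::
  "nat \<Rightarrow> (nat \<Rightarrow> real) \<Rightarrow> (nat \<Rightarrow> real ^ 'n \<Rightarrow> real) \<Rightarrow> real \<Rightarrow> (real ^ 'n \<Rightarrow> real) \<Rightarrow>
   ((nat \<Rightarrow> real ^ 'n \<Rightarrow> real) \<Rightarrow> real ^ 'n \<Rightarrow> ennreal) \<Rightarrow> bool" where
  "bounded_multi m r \<mu> s \<nu> T \<longleftrightarrow>
     (\<exists>C>0. \<forall>f. (\<forall>i\<in>{1..m}. f i \<in> wLp (r i) (\<mu> i)) \<longrightarrow>
        wLp_norm s \<nu> (T f) \<le> ennreal C * (\<Prod>i=1..m. wLp_norm (r i) (\<mu> i) (\<lambda>x. ennreal \<bar>f i x\<bar>)))"

end

theory Submission
  imports Defs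
begin

text \<open>Put \<open>c B = \<phi>(|B|) \<Prod>\<^sub>i |B|\<^sup>-\<^sup>1 \<integral>\<^sub>B
  |f\<^sub>i|\<close>, so that the operator is the supremum of \<open>c B\<close> over \<open>B \<ni>
  x\<close>. By Lindelof's theorem and monotone convergence it suffices to treat finitely many sets.
  Greedy selection by decreasing \<open>c\<close> gives sets \<open>B\<^sub>j\<close> with disjoint
  parts \<open>E\<^sub>j \<subseteq> B\<^sub>j\<close>, \<open>(1 - \<gamma>) |B\<^sub>j| \<le>
  |E\<^sub>j|\<close>, and the Tauberian condition bounds the measure of each superlevel set by that
  of the selected sets in it. The layer cake formula turns this into \<open>\<integral> (sup
  c)\<^sup>q v\<^sup>q \<le> C \<Sum>\<^sub>j c(B\<^sub>j)\<^sup>q v\<^sup>q(B\<^sub>j)\<close>.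
  Hoelder's inequality for the \<open>Y\<^sub>i\<close>-averages and the testing condition bound the
  \<open>j\<close>-th term by \<open>K\<^sup>q (|B\<^sub>j| (\<Prod>\<^sub>i \<parallel>f\<^sub>i
  w\<^sub>i\<parallel>)\<^sup>p)\<^sup>q\<^sup>/\<^sup>p\<close>, with
  \<open>Y\<^sub>i'\<close>-averages over \<open>B\<^sub>j\<close>. As \<open>q/p \<ge> 1\<close> the
  exponent moves outside the sum, and \<open>|B\<^sub>j|\<close> may be replaced by
  \<open>|E\<^sub>j|\<close>, so the disjointness of the \<open>E\<^sub>j\<close> leaves the
  \<open>L\<^sup>p\<close>-norm of the maximal operator of the associate spaces at \<open>(f\<^sub>i
  w\<^sub>i)\<^sub>i\<close>.\<close>

section \<open>Powers of extended non-negative reals\<close>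

lemma epowr_ennreal: "0 \<le> x \<Longrightarrow> epowr (ennreal x) a = ennreal (x powr a)"
  by (simp add: epowr_def)

lemma epowr_top [simp]: "epowr top a = top"
  by (simp add: epowr_def)

lemma epowr_0 [simp]: "epowr 0 a = 0"
  by (simp add: epowr_def)

lemma epowr_1_right [simp]: "epowr x 1 = x"
  by (cases x) (simp_all add: epowr_ennreal)

lemma epowr_eq_0_iff [simp]: "epowr x a = 0 \<longleftrightarrow> x = 0"
  by (cases x) (auto simp: epowr_ennreal)

lemma epowr_mono: "x \<le> y \<Longrightarrow> 0 \<le> a \<Longrightarrow> epowr x a \<le> epowr y a"
  by (cases x; cases y) (auto simp: epowr_ennreal top_unique intro!: ennreal_leI powr_mono2)

text \<open>Powers with any exponent fix 0 and \<open>top\<close>, so they respect the convention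
  \<open>0 * top = 0\<close>.\<close>

lemma epowr_mult: "epowr (x * y) a = epowr x a * epowr y a"
proof (cases "x = 0 \<or> y = 0")
  case False
  then show ?thesis
    by (cases x; cases y)
      (auto simp: epowr_ennreal powr_mult ennreal_top_mult ennreal_mult_top simp flip: ennreal_mult)
qed auto

lemma epowr_epowr: "epowr (epowr x a) b = epowr x (a * b)"
  by (cases x) (simp_all add: epowr_ennreal powr_powr)

text \<open>For \<open>a > 0\<close> the power is an increasing bijection whose inverse has exponent
  \<open>1 / a\<close>; as 0 is fixed, the empty family is covered too.\<close>

lemma epowr_SUP:
  assumes "0 < a"
  shows "epowr (SUP i\<in>I. f i) a = (SUP i\<in>I. epowr (f i) a)"
proof (rule antisym)
  let ?s = "SUP i\<in>I. epowr (f i) a"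
  have "f i \<le> epowr ?s (1 / a)" if "i \<in> I" for i
  proof -
    have "epowr (epowr (f i) a) (1 / a) \<le> epowr ?s (1 / a)"
      using assms that by (intro epowr_mono SUP_upper) auto
    then show ?thesis
      using assms by (simp add: epowr_epowr)
  qed
  then have "epowr (SUP i\<in>I. f i) a \<le> epowr (epowr ?s (1 / a)) a"
    using assms by (intro epowr_mono SUP_least) auto
  then show "epowr (SUP i\<in>I. f i) a \<le> ?s"
    using assms by (simp add: epowr_epowr)
next
  show "(SUP i\<in>I. epowr (f i) a) \<le> epowr (SUP i\<in>I. f i) a"
    using assms by (intro SUP_least epowr_mono SUP_upper) auto
qed

text \<open>After division by \<open>r + s\<close> both summands lie between 0 and 1, where a power
  with exponent \<open>a \<ge> 1\<close> only decreases, and the two ratios add up to 1.\<close>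

lemma epowr_superadditive:
  assumes "1 \<le> a"
  shows "epowr x a + epowr y a \<le> epowr (x + y) a"
proof (cases "x = top \<or> y = top")
  case False
  then obtain r s where rs: "x = ennreal r" "y = ennreal s" "0 \<le> r" "0 \<le> s"
    by (metis enn2real_nonneg ennreal_enn2real_if)
  have "r powr a + s powr a \<le> (r + s) powr a"
  proof (cases "r + s = 0")
    case True
    with rs have "r = 0" "s = 0" by auto
    then show ?thesis by simp
  next
    case False
    define t where "t = r + s"
    have t: "0 < t" using False rs by (simp add: t_def)
    have le: "u powr a \<le> u / t * t powr a" if "0 \<le> u" "u \<le> t" for u
    proof -
      have "(u / t) powr a \<le> (u / t) powr 1"
        using that t assms by (intro powr_mono') auto
      then show ?thesis
        using that t by (simp add: powr_divide field_simps)
    qed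
    have "r powr a + s powr a \<le> r / t * t powr a + s / t * t powr a"
      using rs t_def by (intro add_mono le) auto
    also have "\<dots> = (r + s) / t * t powr a"
      by (simp only: add_divide_distrib distrib_right)
    also have "\<dots> = t powr a"
      using t by (simp add: t_def)
    finally show ?thesis by (simp add: t_def)
  qed
  then show ?thesis
    using rs by (simp add: epowr_ennreal flip: ennreal_plus)
qed auto

lemma sum_epowr_le:
  "1 \<le> a \<Longrightarrow> (\<Sum>i\<in>I. epowr (f i) a) \<le> epowr (\<Sum>i\<in>I. f i) a"
proof (induction I rule: infinite_finite_induct)
  case (insert i I)
  then have "(\<Sum>i\<in>insert i I. epowr (f i) a) \<le> epowr (f i) a + epowr (\<Sum>i\<in>I. f i) a"
    by (simp add: add_left_mono)
  also have "\<dots> \<le> epowr (\<Sum>i\<in>insert i I. f i) a"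
    using insert by (simp add: epowr_superadditive)
  finally show ?case .
qed simp_all

section \<open>Integration through superlevel sets\<close>

text \<open>The value \<open>f x\<close> is the length of the set of all \<open>s \<ge> 0\<close>
  below it; Tonelli's theorem then exchanges the two integrations.\<close>

lemma (in sigma_finite_measure) nn_integral_layer_cake:
  assumes [measurable]: "f \<in> borel_measurable M"
  shows "(\<integral>\<^sup>+x. f x \<partial>M) = (\<integral>\<^sup>+s\<in>{0..}. emeasure M {x \<in> space M. ennreal s < f x} \<partial>lborel)"
proof -
  interpret pair_sigma_finite M lborel ..
  have "f x = (\<integral>\<^sup>+s. indicator {s. 0 \<le> s \<and> ennreal s < f x} s \<partial>lborel)" for x
  proof (cases "f x")
    case (real r)
    then have "{s. 0 \<le> s \<and> ennreal s < f x} = {0..<r}"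
      by (auto simp: ennreal_less_iff)
    then show ?thesis using real by simp
  next
    case top
    then have "{s. 0 \<le> s \<and> ennreal s < f x} = {0..}"
      by auto
    moreover have "emeasure lborel {0::real..} = top"
    proof (cases "emeasure lborel {0::real..}")
      case (real r)
      have "emeasure lborel {0..r + 1} \<le> emeasure lborel {0::real..}"
        by (rule emeasure_mono) auto
      with real show ?thesis by simp
    qed
    ultimately show ?thesis using top by simp
  qed
  then have "(\<integral>\<^sup>+x. f x \<partial>M) =
      (\<integral>\<^sup>+x. \<integral>\<^sup>+s. indicator {s. 0 \<le> s \<and> ennreal s < f x} s \<partial>lborel \<partial>M)"
    by simp
  also have "\<dots> = (\<integral>\<^sup>+s. \<integral>\<^sup>+x. indicator {s. 0 \<le> s \<and> ennreal s < f x} s \<partial>M \<partial>lborel)"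
    by (rule Fubini'[symmetric]) measurable
  also have "\<dots> = (\<integral>\<^sup>+s\<in>{0..}. emeasure M {x \<in> space M. ennreal s < f x} \<partial>lborel)"
  proof (rule nn_integral_cong)
    fix s :: real
    have "(\<integral>\<^sup>+x. indicator {s. 0 \<le> s \<and> ennreal s < f x} s \<partial>M) =
        (\<integral>\<^sup>+x. indicator {0..} s * indicator {x \<in> space M. ennreal s < f x} x \<partial>M)"
      by (rule nn_integral_cong) (auto split: split_indicator)
    then show "(\<integral>\<^sup>+x. indicator {s. 0 \<le> s \<and> ennreal s < f x} s \<partial>M) =
        emeasure M {x \<in> space M. ennreal s < f x} * indicator {0..} s"
      by (simp add: nn_integral_cmult mult.commute)
  qed
  finally show ?thesis .
qed

text \<open>A comparison with one constant at all levels can be integrated over the levels. This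
  leads from the Tauberian condition, which concerns sets, to integrals of functions.\<close>

lemma (in sigma_finite_measure) nn_integral_mono_superlevel:
  assumes [measurable]: "f \<in> borel_measurable M" "g \<in> borel_measurable M"
    and le: "\<And>t. emeasure M {x \<in> space M. t < f x} \<le> C * emeasure M {x \<in> space M. t < g x}"
  shows "(\<integral>\<^sup>+x. f x \<partial>M) \<le> C * (\<integral>\<^sup>+x. g x \<partial>M)"
proof -
  have "(\<integral>\<^sup>+x. f x \<partial>M) \<le>
      (\<integral>\<^sup>+s. C * (emeasure M {x \<in> space M. ennreal s < g x} * indicator {0..} s) \<partial>lborel)"
    unfolding nn_integral_layer_cake[OF assms(1)] using le
    by (intro nn_integral_mono) (auto split: split_indicator)
  also have "\<dots> = C * (\<integral>\<^sup>+x. g x \<partial>M)"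
    unfolding nn_integral_layer_cake[OF assms(2)]
    by (rule nn_integral_cmult) measurable
  finally show ?thesis .
qed


section \<open>Greedy selection of sets with large disjoint parts\<close>

lemma inverse_le_inverse_ennreal: "inverse x \<le> inverse y \<longleftrightarrow> y \<le> (x :: ennreal)"
proof (cases x; cases y)
  fix r s assume "x = ennreal r" "0 \<le> r" "y = ennreal s" "0 \<le> s"
  then show ?thesis
    by (cases "r = 0"; cases "s = 0") (auto simp: inverse_ennreal top_unique)
qed (auto simp: top_unique)

text \<open>Since \<open>lebesgue\<close> completes \<open>lborel\<close>, a countable cover by sets
  of finite \<open>lborel\<close> measure still serves.\<close>

lemma sigma_finite_lebesgue: "sigma_finite_measure (lebesgue :: 'a::euclidean_space measure)"
proof
  obtain A :: "'a set set" where "countable A" "A \<subseteq> sets lborel" "\<Union>A = space lborel"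
    "\<forall>a\<in>A. emeasure lborel a \<noteq> \<infinity>"
    using lborel.sigma_finite_countable by blast
  then show "\<exists>A. countable A \<and> A \<subseteq> sets lebesgue \<and> \<Union>A = space (lebesgue :: 'a measure) \<and>
      (\<forall>a\<in>A. emeasure lebesgue a \<noteq> \<infinity>)"
    by (intro exI[of _ A]) auto
qed


text \<open>Candidates are examined by decreasing \<open>c\<close>, and one is discarded when the sets selected so far
  already fill more than a proportion \<open>\<gamma>\<close> of it. This order makes the selection compatible with
  every superlevel set of \<open>c\<close>.\<close>

lemma greedy_selection:
  fixes c :: "'a set \<Rightarrow> ennreal"
  assumes "finite F" "F \<subseteq> sets M" "\<And>B. B \<in> F \<Longrightarrow> emeasure M B < \<infinity>" "0 \<le> \<gamma>" "\<gamma> \<le> 1"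
  shows "\<exists>S\<subseteq>F. \<exists>E. disjoint_family_on E S \<and>
      (\<forall>B\<in>S. E B \<in> sets M \<and> E B \<subseteq> B \<and> (1 - \<gamma>) * measure M B \<le> measure M (E B)) \<and>
      (\<forall>B\<in>F - S. \<gamma> * measure M B < measure M (B \<inter> \<Union>{B'\<in>S. c B \<le> c B'}))"
  using assms(1-3)
\<comment> \<open>This induction always adds an element of largest rank, so ranking by
  \<open>inverse (c B)\<close> visits the sets by decreasing \<open>c\<close>.\<close>
proof (induction F rule: finite_ranking_induct[where f = "\<lambda>B. inverse (c B)"])
  case empty
  show ?case by (intro exI[of _ "{}"] conjI) (simp_all add: disjoint_family_on_def)
next
  case (insert X F)
  have IH: "\<exists>S\<subseteq>F. \<exists>E. disjoint_family_on E S \<and>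
      (\<forall>B\<in>S. E B \<in> sets M \<and> E B \<subseteq> B \<and> (1 - \<gamma>) * measure M B \<le> measure M (E B)) \<and>
      (\<forall>B\<in>F - S. \<gamma> * measure M B < measure M (B \<inter> \<Union>{B'\<in>S. c B \<le> c B'}))"
    by (rule insert.IH) (use insert.prems in auto)
  then obtain S E where S: "S \<subseteq> F" and disj: "disjoint_family_on E S"
    and E: "\<forall>B\<in>S. E B \<in> sets M \<and> E B \<subseteq> B \<and> (1 - \<gamma>) * measure M B \<le> measure M (E B)"
    and rest: "\<forall>B\<in>F - S. \<gamma> * measure M B < measure M (B \<inter> \<Union>{B'\<in>S. c B \<le> c B'})"
    by (elim exE conjE)
  have X: "X \<in> sets M" "emeasure M X < \<infinity>"
    using insert.prems by auto
  have fS: "finite S"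
    using S insert.hyps finite_subset by blast
  then have US: "\<Union>S \<in> sets M"
    using S insert.prems by (intro sets.finite_Union) auto
  have cX: "c X \<le> c B" if "B \<in> F" for B
  proof -
    have "inverse (c B) \<le> inverse (c X)" using insert.hyps that by auto
    then show ?thesis by (simp add: inverse_le_inverse_ennreal)
  qed
  \<comment> \<open>The new set may be present already; otherwise it is discarded or selected
    according to the proportion of it that \<open>S\<close> fills.\<close>
  consider "X \<in> F" | "X \<notin> F" "\<gamma> * measure M X < measure M (X \<inter> \<Union>S)"
    | "X \<notin> F" "measure M (X \<inter> \<Union>S) \<le> \<gamma> * measure M X" by fastforce
  then show ?case
  proof cases
    case 1
    then show ?thesis using IH by (simp only: insert_absorb)
  next
    case 2
    \<comment> \<open>No earlier set has a value below \<open>c X\<close>, so the restriction to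
      \<open>c X \<le> c B'\<close> keeps all of \<open>S\<close>.\<close>
    have "{B' \<in> S. c X \<le> c B'} = S" using cX S by auto
    with 2 have "\<gamma> * measure M X < measure M (X \<inter> \<Union>{B'\<in>S. c X \<le> c B'})"
      by (simp only:)
    with rest have "\<forall>B\<in>insert X F - S. \<gamma> * measure M B < measure M (B \<inter> \<Union>{B'\<in>S. c B \<le> c B'})"
      by blast
    with S disj E show ?thesis by (intro exI[of _ S] exI[of _ E] conjI) blast+
  next
    case 3
    \<comment> \<open>The part assigned to \<open>X\<close> is what the earlier sets leave
      uncovered; it is disjoint from their parts and has at least the proportion
      \<open>1 - \<gamma>\<close> of \<open>X\<close>.\<close>
    define E' where "E' = E(X := X - \<Union>S)"
    have XS: "X \<notin> S" using 3 S by auto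
    have "measure M ((X \<inter> \<Union>S) \<union> (X - \<Union>S)) = measure M (X \<inter> \<Union>S) + measure M (X - \<Union>S)"
      using X US emeasure_mono[of "X \<inter> \<Union>S" X M] emeasure_mono[of "X - \<Union>S" X M]
      by (intro measure_Union) (auto simp: top_unique)
    then have "measure M X = measure M (X \<inter> \<Union>S) + measure M (X - \<Union>S)"
      by (simp add: Int_Diff_Un)
    with 3 have "(1 - \<gamma>) * measure M X \<le> measure M (X - \<Union>S)"
      by (simp add: algebra_simps)
    then have "\<forall>B\<in>insert X S. E' B \<in> sets M \<and> E' B \<subseteq> B \<and> (1 - \<gamma>) * measure M B \<le> measure M (E' B)"
      using E X US by (auto simp: E'_def)
    moreover have "disjoint_family_on E' (insert X S)"
    proof -
      have "E B \<subseteq> \<Union>S" if "B \<in> S" for B using E that by blast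
      then show ?thesis
        using disj XS by (auto simp: disjoint_family_on_insert E'_def disjoint_family_on_def)
    qed
    \<comment> \<open>Sets discarded earlier stay covered, because a larger selection can only
      enlarge the union.\<close>
    moreover have rest': "\<forall>B\<in>insert X F - insert X S.
        \<gamma> * measure M B < measure M (B \<inter> \<Union>{B'\<in>insert X S. c B \<le> c B'})"
    proof
      fix B assume that: "B \<in> insert X F - insert X S"
      have B: "B \<in> F - S" using that by blast
      let ?U = "\<lambda>S. B \<inter> \<Union>{B'\<in>S. c B \<le> c B'}"
      have Bm: "B \<in> sets M" "emeasure M B < \<infinity>"
        using insert.prems B by simp_all blast
      have U: "?U G \<in> sets M" if "G \<subseteq> insert X S" for G
      proof (intro sets.Int sets.finite_Union Bm(1))
        show "finite {B'\<in>G. c B \<le> c B'}"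
          by (rule finite_subset[of _ "insert X S"]) (use that fS in auto)
        show "{B'\<in>G. c B \<le> c B'} \<subseteq> sets M"
          using that S insert.prems(1) by blast
      qed
      have "\<gamma> * measure M B < measure M (?U S)"
        by (rule bspec[OF rest B])
      also have "\<dots> \<le> measure M (?U (insert X S))"
      proof (rule measure_mono_fmeasurable)
        show "?U S \<subseteq> ?U (insert X S)" by blast
        show "?U S \<in> sets M" by (rule U) blast
        show "?U (insert X S) \<in> fmeasurable M"
        proof (rule fmeasurableI2)
          show "B \<in> fmeasurable M" using Bm by (simp add: fmeasurable_def)
          show "?U (insert X S) \<in> sets M" by (rule U) blast
        qed blast
      qed
      finally show "\<gamma> * measure M B < measure M (?U (insert X S))" .
    qed
    moreover have "insert X S \<subseteq> insert X F" using S by blast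
    ultimately show ?thesis
      by (intro exI[of _ "insert X S"] exI[of _ E'] conjI)
  qed
qed

section \<open>Weighted measures and the Tauberian covering estimate\<close>

lemma basisD:
  assumes "basis \<B>" "B \<in> \<B>"
  shows "open B" "B \<noteq> {}" "emeasure lebesgue B < \<infinity>" "B \<in> sets lebesgue" "0 < vol B"
    "ennreal (vol B) = emeasure lebesgue B"
proof -
  show B: "open B" "B \<noteq> {}" "emeasure lebesgue B < \<infinity>"
    using assms by (auto simp: basis_def)
  then show "B \<in> sets lebesgue" by auto
  show eq: "ennreal (vol B) = emeasure lebesgue B"
    using B by (intro emeasure_eq_ennreal_measure[symmetric]) auto
  have "0 < emeasure lebesgue B"
    using B open_not_negligible[of B] by (auto simp: negligible_iff_emeasure0 zero_less_iff_neq_zero)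
  then show "0 < vol B"
    using eq by (metis ennreal_less_zero_iff)
qed

text \<open>The sets are arbitrary, so this applies directly to superlevel sets of the maximal
  operator.\<close>

lemma wmeasure_mono: "A \<subseteq> B \<Longrightarrow> wmeasure w A \<le> wmeasure w B"
  unfolding wmeasure_def by (intro nn_integral_mono) (auto split: split_indicator)

lemma wmeasure_eq_emeasure_density:
  assumes "w \<in> borel_measurable lebesgue" "A \<in> sets lebesgue"
  shows "wmeasure w A = emeasure (density lebesgue (\<lambda>x. ennreal (w x))) A"
  using assms by (simp add: wmeasure_def emeasure_density)

lemma average_indicator:
  assumes "E \<in> sets lebesgue" "B \<in> sets lebesgue"
  shows "average B (indicator E) = emeasure lebesgue (B \<inter> E) / ennreal (vol B)"
proof -
  have "(\<integral>\<^sup>+y\<in>B. ennreal \<bar>indicator E y\<bar> \<partial>lebesgue) = (\<integral>\<^sup>+y. indicator (B \<inter> E) y \<partial>lebesgue)"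
    by (intro nn_integral_cong) (auto split: split_indicator)
  then show ?thesis
    using assms by (simp add: average_def)
qed

text \<open>One selection handles all levels of \<open>d\<close> at once, because it is greedy with
  respect to \<open>d\<close>. The sum over \<open>S\<close> controls the weighted integral, while
  the disjoint parts \<open>E\<close> are kept for the later estimate in Lebesgue measure.\<close>

lemma covering_selection:
  fixes \<B> :: "(real ^ 'n) set set" and d :: "(real ^ 'n) set \<Rightarrow> ennreal"
  assumes \<B>: "basis \<B>" and \<gamma>: "0 < \<gamma>" "\<gamma> < 1" and \<mu>: "weight \<mu>"
    and C: "\<And>E. E \<in> sets lebesgue \<Longrightarrow>
      wmeasure \<mu> {x. maximal_op \<B> (indicator E) x > ennreal \<gamma>} \<le> C * wmeasure \<mu> E"
    and F: "finite F" "F \<subseteq> \<B>"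
  obtains S E where "S \<subseteq> F" "disjoint_family_on E S"
    "\<And>B. B \<in> S \<Longrightarrow> E B \<in> sets lebesgue \<and> E B \<subseteq> B \<and> (1 - \<gamma>) * vol B \<le> vol (E B)"
    "(\<integral>\<^sup>+x. (SUP B\<in>{B\<in>F. x \<in> B}. d B) * ennreal (\<mu> x) \<partial>lebesgue) \<le> C * (\<Sum>B\<in>S. d B * wmeasure \<mu> B)"
proof -
  note B = basisD[OF \<B> subsetD[OF F(2)]]
  have "\<exists>S\<subseteq>F. \<exists>E. disjoint_family_on E S \<and>
      (\<forall>B\<in>S. E B \<in> sets lebesgue \<and> E B \<subseteq> B \<and> (1 - \<gamma>) * vol B \<le> vol (E B)) \<and>
      (\<forall>B\<in>F - S. \<gamma> * vol B < vol (B \<inter> \<Union>{B'\<in>S. d B \<le> d B'}))"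
    using B F \<gamma> by (intro greedy_selection) auto
  then obtain S E where S: "S \<subseteq> F" and SE: "disjoint_family_on E S"
      "\<And>B. B \<in> S \<Longrightarrow> E B \<in> sets lebesgue \<and> E B \<subseteq> B \<and> (1 - \<gamma>) * vol B \<le> vol (E B)"
    and rest: "\<And>B. B \<in> F - S \<Longrightarrow> \<gamma> * vol B < vol (B \<inter> \<Union>{B'\<in>S. d B \<le> d B'})"
    by auto
  have fS: "finite S" using S F finite_subset by blast
  have open_level: "open (\<Union>{B\<in>G. t < d B})" if "G \<subseteq> F" for t G
    using that B by auto
  have level: "wmeasure \<mu> (\<Union>{B\<in>F. t < d B}) \<le> C * wmeasure \<mu> (\<Union>{B\<in>S. t < d B})" for t
  proof -
    let ?U = "\<Union>{B\<in>S. t < d B}"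
    have U: "?U \<in> sets lebesgue" using open_level[OF S] by auto
    \<comment> \<open>If \<open>?U\<close> fills more than a proportion \<open>\<gamma>\<close> of
      \<open>B\<close>, then \<open>B\<close> lies in the superlevel set to which the Tauberian
      condition for \<open>?U\<close> applies.\<close>
    have "ennreal \<gamma> < average B (indicator ?U)" if "B \<in> F" "t < d B" for B
    proof -
      have "\<gamma> * vol B < vol (B \<inter> ?U)"
      proof (cases "B \<in> S")
        case True
        with that have "B \<inter> ?U = B" by auto
        then show ?thesis using \<gamma> B(5)[OF that(1)] by simp
      next
        case False
        \<comment> \<open>The sets that cover a discarded \<open>B\<close> satisfy
          \<open>d B' \<ge> d B > t\<close>, so all of them are contained in
          \<open>?U\<close>.\<close>
        with that have "\<gamma> * vol B < vol (B \<inter> \<Union>{B'\<in>S. d B \<le> d B'})" by (intro rest) auto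
        also have "\<dots> \<le> vol (B \<inter> ?U)"
        proof (rule measure_mono_fmeasurable)
          have "open (\<Union>{B'\<in>S. d B \<le> d B'})" using S B by auto
          then show "B \<inter> \<Union>{B'\<in>S. d B \<le> d B'} \<in> sets lebesgue" using B(4)[OF that(1)] by auto
          show "B \<inter> ?U \<in> lmeasurable"
            using U B(3,4)[OF that(1)] by (intro fmeasurable_Int_fmeasurable) (auto simp: fmeasurable_def)
        qed (use that in auto)
        finally show ?thesis .
      qed
      moreover have "emeasure lebesgue (B \<inter> ?U) = ennreal (vol (B \<inter> ?U))"
        using B(3,4)[OF that(1)] emeasure_mono[of "B \<inter> ?U" B lebesgue]
        by (intro emeasure_eq_ennreal_measure) (auto simp: top_unique)
      ultimately show ?thesis
        using B(4,5)[OF that(1)] U \<gamma> by (simp add: average_indicator divide_ennreal ennreal_less_iff pos_less_divide_eq)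
    qed
    then have "\<Union>{B\<in>F. t < d B} \<subseteq> {x. maximal_op \<B> (indicator ?U) x > ennreal \<gamma>}"
      using F by (fastforce simp: maximal_op_def less_SUP_iff)
    then show ?thesis
      using wmeasure_mono C[OF U] order_trans by blast
  qed
  have [measurable]: "\<mu> \<in> borel_measurable lebesgue" using \<mu> by (simp add: weight_def)
  define N where "N = density lebesgue (\<lambda>x. ennreal (\<mu> x))"
  interpret leb: sigma_finite_measure "lebesgue :: (real ^ 'n) measure"
    by (rule sigma_finite_lebesgue)
  \<comment> \<open>The density has finite values, so \<open>N\<close> inherits sigma-finiteness, on
    which the layer cake formula rests.\<close>
  interpret N: sigma_finite_measure N
    unfolding N_def by (subst leb.sigma_finite_iff_density_finite) auto
  define f where "f x = (SUP B\<in>{B\<in>F. x \<in> B}. d B)" for x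
  \<comment> \<open>On a selected set with \<open>d B > t\<close> the sum is at least its term for
    \<open>B\<close>, so the superlevel set of \<open>g\<close> contains the union in
    \<open>level\<close>.\<close>
  define g where "g x = (\<Sum>B\<in>S. d B * indicator B x)" for x
  have fset: "{x. t < f x} = \<Union>{B\<in>F. t < d B}" for t
    by (auto simp: f_def less_SUP_iff)
  have gset: "\<Union>{B\<in>S. t < d B} \<subseteq> {x. t < g x}" for t
  proof safe
    fix x X assume X: "X \<in> S" "x \<in> X" "t < d X"
    have "d X * indicator X x \<le> g x"
      unfolding g_def using X fS by (intro member_le_sum) auto
    with X show "t < g x" by (auto intro: less_le_trans)
  qed
  have f_meas: "f \<in> borel_measurable lebesgue"
    by (rule borel_measurableI_greater) (use fset open_level[of F] in auto)
  have g_meas: "g \<in> borel_measurable lebesgue"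
    unfolding g_def using S B(4)
    by (intro borel_measurable_sum borel_measurable_times borel_measurable_indicator) auto
  have "(\<integral>\<^sup>+x. f x \<partial>N) \<le> C * (\<integral>\<^sup>+x. g x \<partial>N)"
  proof (rule N.nn_integral_mono_superlevel)
    fix t
    have gm: "{x. t < g x} \<in> sets lebesgue"
      using borel_measurable_less[OF borel_measurable_const g_meas, of t] by simp
    have "wmeasure \<mu> {x. t < f x} \<le> C * wmeasure \<mu> {x. t < g x}"
      unfolding fset by (intro order_trans[OF level] mult_left_mono wmeasure_mono gset) simp
    then show "emeasure N {x \<in> space N. t < f x} \<le> C * emeasure N {x \<in> space N. t < g x}"
      using gm open_level[of F t] by (simp add: wmeasure_eq_emeasure_density N_def fset)
  qed (use f_meas g_meas in \<open>simp_all add: N_def\<close>)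
  also have "(\<integral>\<^sup>+x. g x \<partial>N) = (\<Sum>B\<in>S. \<integral>\<^sup>+x. d B * indicator B x \<partial>N)"
    unfolding g_def using S B(4) by (intro nn_integral_sum) (auto simp: N_def)
  also have "\<dots> = (\<Sum>B\<in>S. d B * wmeasure \<mu> B)"
    using S B(4)
    by (intro sum.cong refl, subst nn_integral_cmult_indicator) (auto simp: N_def wmeasure_eq_emeasure_density)
  also have "(\<integral>\<^sup>+x. f x \<partial>N) = (\<integral>\<^sup>+x. f x * ennreal (\<mu> x) \<partial>lebesgue)"
    using f_meas by (simp add: N_def nn_integral_density mult.commute)
  finally show thesis
    using that[OF S SE] by (simp add: f_def)
qed

section \<open>Reduction of suprema to finite subfamilies\<close>

text \<open>For each rational level, Lindelof's theorem replaces the sets above that level by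
  countably many with the same union. A gap between the two suprema would contain a rational
  level.\<close>

lemma countable_SUP_open_cover:
  fixes \<B> :: "'a::second_countable_topology set set" and c :: "'a set \<Rightarrow> ennreal"
  assumes "\<And>B. B \<in> \<B> \<Longrightarrow> open B"
  obtains D where "D \<subseteq> \<B>" "countable D"
    "\<And>x. (SUP B\<in>{B\<in>\<B>. x \<in> B}. c B) = (SUP B\<in>{B\<in>D. x \<in> B}. c B)"
proof -
  have "\<exists>D \<subseteq> {B\<in>\<B>. ennreal (real_of_rat r) < c B}. countable D \<and>
      \<Union>D = \<Union>{B\<in>\<B>. ennreal (real_of_rat r) < c B}" for r
    by (rule Lindelof[of "{B\<in>\<B>. ennreal (real_of_rat r) < c B}"]) (use assms in auto)
  then obtain D where D: "\<And>r. D r \<subseteq> {B\<in>\<B>. ennreal (real_of_rat r) < c B}"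
      "\<And>r. countable (D r)" "\<And>r. \<Union>(D r) = \<Union>{B\<in>\<B>. ennreal (real_of_rat r) < c B}"
    by metis
  show thesis
  proof (rule that[of "\<Union>r. D r"])
    show "(\<Union>r. D r) \<subseteq> \<B>" "countable (\<Union>r. D r)" using D by auto
    fix x
    show "(SUP B\<in>{B\<in>\<B>. x \<in> B}. c B) = (SUP B\<in>{B\<in>(\<Union>r. D r). x \<in> B}. c B)"
    proof (rule antisym)
      show "(SUP B\<in>{B\<in>\<B>. x \<in> B}. c B) \<le> (SUP B\<in>{B\<in>(\<Union>r. D r). x \<in> B}. c B)"
      proof (rule ccontr)
        assume "\<not> ?thesis"
        then obtain X where X: "X \<in> \<B>" "x \<in> X" "(SUP B\<in>{B\<in>(\<Union>r. D r). x \<in> B}. c B) < c X"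
          by (auto simp: not_le less_SUP_iff)
        then obtain r where r: "(SUP B\<in>{B\<in>(\<Union>r. D r). x \<in> B}. c B) < real_of_rat r" "real_of_rat r < c X"
          using ennreal_rat_dense by blast
        then have "x \<in> \<Union>(D r)" unfolding D(3) using X by auto
        then obtain Z where Z: "Z \<in> D r" "x \<in> Z" by auto
        then have "ennreal (real_of_rat r) < c Z" using D(1) by auto
        also have "c Z \<le> (SUP B\<in>{B\<in>(\<Union>r. D r). x \<in> B}. c B)"
          using Z by (intro SUP_upper) auto
        finally show False using r by simp
      qed
      show "(SUP B\<in>{B\<in>(\<Union>r. D r). x \<in> B}. c B) \<le> (SUP B\<in>{B\<in>\<B>. x \<in> B}. c B)"
        using D by (intro SUP_subset_mono) auto
    qed
  qed
qed

lemma nn_integral_SUP_le_finite: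
  fixes \<B> :: "'a::euclidean_space set set" and c :: "'a set \<Rightarrow> ennreal"
  assumes op: "\<And>B. B \<in> \<B> \<Longrightarrow> open B" and u [measurable]: "u \<in> borel_measurable lebesgue"
    and le: "\<And>F. finite F \<Longrightarrow> F \<subseteq> \<B> \<Longrightarrow> (\<integral>\<^sup>+x. (SUP B\<in>{B\<in>F. x \<in> B}. c B) * u x \<partial>lebesgue) \<le> K"
  shows "(\<integral>\<^sup>+x. (SUP B\<in>{B\<in>\<B>. x \<in> B}. c B) * u x \<partial>lebesgue) \<le> K"
proof -
  obtain D where D: "D \<subseteq> \<B>" "countable D"
    "\<And>x. (SUP B\<in>{B\<in>\<B>. x \<in> B}. c B) = (SUP B\<in>{B\<in>D. x \<in> B}. c B)"
    using countable_SUP_open_cover[OF op, of \<B> c] by metis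
  \<comment> \<open>An enumeration exhausts \<open>D\<close> by increasing finite subfamilies, which
    prepares monotone convergence.\<close>
  define F where "F n = {B\<in>D. to_nat_on D B \<le> n}" for n
  have fin: "finite (F n)" for n
  proof (rule finite_imageD)
    show "finite (to_nat_on D ` F n)" by (rule finite_subset[of _ "{..n}"]) (auto simp: F_def)
    show "inj_on (to_nat_on D) (F n)"
      by (rule inj_on_subset[OF inj_on_to_nat_on[OF D(2)]]) (auto simp: F_def)
  qed
  define f where "f n x = (SUP B\<in>{B\<in>F n. x \<in> B}. c B)" for n x
  have fset: "{x. t < f n x} = \<Union>{B\<in>F n. t < c B}" for t n
    by (auto simp: f_def less_SUP_iff)
  have opF: "open (\<Union>{B\<in>F n. t < c B})" for n t
    using D(1) op by (auto simp: F_def)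
  have meas [measurable]: "f n \<in> borel_measurable lebesgue" for n
    by (rule borel_measurableI_greater) (use fset opF in auto)
  have "(SUP B\<in>{B\<in>D. x \<in> B}. c B) = (SUP n. f n x)" for x
  proof (rule antisym)
    show "(SUP B\<in>{B\<in>D. x \<in> B}. c B) \<le> (SUP n. f n x)"
    proof (rule SUP_least)
      fix X assume "X \<in> {B\<in>D. x \<in> B}"
      then have "c X \<le> f (to_nat_on D X) x"
        unfolding f_def by (intro SUP_upper) (auto simp: F_def)
      then show "c X \<le> (SUP n. f n x)" by (rule SUP_upper2[rotated]) simp
    qed
    show "(SUP n. f n x) \<le> (SUP B\<in>{B\<in>D. x \<in> B}. c B)"
      unfolding f_def by (intro SUP_least SUP_subset_mono) (auto simp: F_def intro!: SUP_upper)
  qed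
  then have "(\<integral>\<^sup>+x. (SUP B\<in>{B\<in>\<B>. x \<in> B}. c B) * u x \<partial>lebesgue) = (\<integral>\<^sup>+x. (SUP n. f n x * u x) \<partial>lebesgue)"
    by (simp add: D(3) SUP_mult_right_ennreal)
  also have "\<dots> = (SUP n. \<integral>\<^sup>+x. f n x * u x \<partial>lebesgue)"
  proof (rule nn_integral_monotone_convergence_SUP)
    show "incseq (\<lambda>n x. f n x * u x)"
      unfolding f_def by (intro incseq_SucI le_funI mult_right_mono SUP_subset_mono) (auto simp: F_def)
  qed measurable
  also have "\<dots> \<le> K"
    using le[OF fin] D(1) by (intro SUP_least) (auto simp: f_def F_def)
  finally show ?thesis .
qed

section \<open>Hoelder's inequality in Banach function spaces\<close>

context banach_function_space
begin

text \<open>Every multiple of the indicator of the set where \<open>F\<close> is infinite lies below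
  \<open>F\<close>. A finite \<open>Y F\<close> therefore forces that indicator to have norm
  0.\<close>

lemma AE_finite:
  assumes [measurable]: "F \<in> borel_measurable lebesgue" and "Y F < \<infinity>"
  shows "AE x in lebesgue. F x < \<infinity>"
proof -
  define A where "A = {x. F x = \<infinity>}"
  have A: "A \<in> sets lebesgue"
    using borel_measurable_eq[OF assms(1) borel_measurable_const, of \<infinity>] by (simp add: A_def)
  have le: "ennreal (real n) * Y (indicator A) \<le> Y F" for n
  proof -
    have "Y (\<lambda>x. ennreal (real n) * indicator A x) \<le> Y F"
      using A by (intro norm_mono) (auto simp: A_def split: split_indicator)
    then show ?thesis using A by (subst (asm) norm_scale) auto
  qed
  have "Y (indicator A) = 0"
  proof (rule ccontr)
    assume ne: "Y (indicator A) \<noteq> 0"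
    have "(SUP n. ennreal (real n) * Y (indicator A)) \<le> Y F"
      using le by (intro SUP_least)
    moreover have "(SUP n. ennreal (real n) * Y (indicator A)) = top"
      using ne by (simp add: SUP_mult_right_ennreal[symmetric] ennreal_SUP_of_nat_eq_top
          ennreal_of_nat_eq_real_of_nat[symmetric] ennreal_top_mult)
    ultimately show False using assms by (simp add: top_unique)
  qed
  then have "AE x in lebesgue. indicator A x = (0 :: ennreal)"
    using A by (subst (asm) norm_eq_0_iff) auto
  then show ?thesis
    by eventually_elim (auto simp: A_def less_top split: split_indicator_asm)
qed

text \<open>Division by \<open>Y F\<close> yields a competitor of norm one in the supremum that
  defines the associate norm; if \<open>Y F = 0\<close>, then \<open>F\<close> vanishes almost
  everywhere.\<close>

lemma holder:
  assumes [measurable]: "F \<in> borel_measurable lebesgue" "G \<in> borel_measurable lebesgue"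
    and fin: "Y F < \<infinity>"
  shows "(\<integral>\<^sup>+x. F x * G x \<partial>lebesgue) \<le> Y F * associate_space Y G"
proof (cases "Y F = 0")
  case True
  then have "AE x in lebesgue. F x = 0" by (simp add: norm_eq_0_iff)
  then have "AE x in lebesgue. F x * G x = 0" by eventually_elim auto
  then have "(\<integral>\<^sup>+x. F x * G x \<partial>lebesgue) = 0" by (subst nn_integral_0_iff_AE) auto
  then show ?thesis by simp
next
  case False
  with fin obtain r where r: "Y F = ennreal r" "0 < r"
    by (cases "Y F") (auto simp: less_top)
  let ?F = "\<lambda>x. ennreal (1 / r) * F x"
  have "Y ?F = 1"
    using r by (subst norm_scale) (auto simp flip: ennreal_mult)
  then have "(\<integral>\<^sup>+x. ?F x * G x \<partial>lebesgue) \<le> associate_space Y G"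
    unfolding associate_space_def by (intro SUP_upper) auto
  also have "(\<integral>\<^sup>+x. ?F x * G x \<partial>lebesgue) = ennreal (1 / r) * (\<integral>\<^sup>+x. F x * G x \<partial>lebesgue)"
    by (subst nn_integral_cmult[symmetric]) (auto simp: mult.assoc)
  finally have "ennreal r * (ennreal (1 / r) * (\<integral>\<^sup>+x. F x * G x \<partial>lebesgue)) \<le> Y F * associate_space Y G"
    using r by (simp add: mult_left_mono)
  then show ?thesis
    using r by (simp add: mult.assoc[symmetric] flip: ennreal_mult)
qed

end

section \<open>Dilations and averages\<close>

lemma measurable_dilate [measurable]:
  "f \<in> borel_measurable lebesgue \<Longrightarrow> dilate \<delta> f \<in> borel_measurable lebesgue"
  unfolding dilate_def by (rule measurable_compose[OF lebesgue_measurable_scaling])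

lemma nn_integral_dilate:
  fixes f :: "real ^ 'n \<Rightarrow> ennreal"
  assumes [measurable]: "f \<in> borel_measurable lebesgue" and "0 < \<delta>"
  shows "(\<integral>\<^sup>+x. f x \<partial>lebesgue) = ennreal (\<delta> ^ CARD('n)) * (\<integral>\<^sup>+x. dilate \<delta> f x \<partial>lebesgue)"
proof -
  \<comment> \<open>This puts scaling into the coordinatewise form of the affine change of
    variables, whose Jacobian is the product of \<open>\<delta>\<close> over all
    coordinates.\<close>
  have T: "(\<lambda>x::real^'n. 0 + (\<Sum>j\<in>Basis. (\<delta> * (x \<bullet> j)) *\<^sub>R j)) = (\<lambda>x. \<delta> *\<^sub>R x)"
    unfolding scaleR_scaleR[symmetric] scaleR_sum_right[symmetric] euclidean_representation by simp
  have "(\<integral>\<^sup>+x. f x \<partial>lebesgue) =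
      (\<integral>\<^sup>+x. f x \<partial>density (distr lebesgue lebesgue (\<lambda>x::real^'n. \<delta> *\<^sub>R x)) (\<lambda>_. (\<Prod>j\<in>(Basis::(real^'n) set). \<bar>\<delta>\<bar>)))"
    using lebesgue_affine_euclidean[where c = "\<lambda>_::real^'n. \<delta>" and t = 0] assms(2) unfolding T by simp
  also have "\<dots> = (\<integral>\<^sup>+x. ennreal (\<delta> ^ CARD('n)) * dilate \<delta> f x \<partial>lebesgue)"
    using assms(2) by (simp add: nn_integral_density nn_integral_distr dilate_def)
  also have "\<dots> = ennreal (\<delta> ^ CARD('n)) * (\<integral>\<^sup>+x. dilate \<delta> f x \<partial>lebesgue)"
    by (rule nn_integral_cmult) measurable
  finally show ?thesis .
qed

text \<open>This excludes zero factors in the testing condition, so that a finite product has only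
  finite factors. A zero norm would make \<open>g\<close> vanish almost everywhere on a set of
  positive measure.\<close>

lemma Y_average_pos:
  fixes B :: "(real ^ 'n) set"
  assumes Y: "banach_function_space Y" and B: "open B" "B \<noteq> {}" "0 < vol B"
    and [measurable]: "g \<in> borel_measurable lebesgue" and pos: "\<And>x. g x \<noteq> 0"
  shows "Y_average Y B g \<noteq> 0"
proof
  interpret banach_function_space Y by fact
  define \<delta> where "\<delta> = vol B powr (1 / real CARD('n))"
  have [measurable]: "B \<in> sets lebesgue" using B by auto
  assume "Y_average Y B g = 0"
  then have "Y (dilate \<delta> (\<lambda>x. g x * indicator B x)) = 0"
    by (simp add: Y_average_def \<delta>_def)
  then have "AE x in lebesgue. dilate \<delta> (\<lambda>x. g x * indicator B x) x = 0"
    by (subst (asm) norm_eq_0_iff) measurable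
  then have "(\<integral>\<^sup>+x. dilate \<delta> (\<lambda>x. g x * indicator B x) x \<partial>lebesgue) = 0"
    by (subst nn_integral_0_iff_AE) measurable
  then have "(\<integral>\<^sup>+x. g x * indicator B x \<partial>lebesgue) = 0"
    using B by (subst nn_integral_dilate[of _ \<delta>]) (auto simp: \<delta>_def)
  then have "AE x in lebesgue. g x * indicator B x = 0"
    by (subst (asm) nn_integral_0_iff_AE) auto
  then have "AE x in lebesgue. x \<notin> B"
    by eventually_elim (use pos in \<open>auto split: split_indicator_asm\<close>)
  then have "B \<in> null_sets lebesgue"
    by (simp add: AE_iff_null_sets)
  then show False using B by (simp add: measure_def null_sets_def)
qed

text \<open>Where \<open>w\<close> vanishes the factorisation \<open>\<bar>f\<bar> = \<bar>f w\<bar> w\<^sup>-\<^sup>1\<close> breaks down; finiteness of the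
  \<open>Y\<close>-average of \<open>w\<^sup>-\<^sup>1\<close> confines this to a null set.\<close>

lemma average_le_Y_averages:
  fixes B :: "(real ^ 'n) set"
  assumes Y: "banach_function_space Y" and B: "B \<in> sets lebesgue" "0 < vol B"
    and f [measurable]: "f \<in> borel_measurable lebesgue" and w: "weight w"
    and fin: "Y_average Y B (\<lambda>x. inverse (ennreal (w x))) < \<infinity>"
  shows "average B f \<le> Y_average Y B (\<lambda>x. inverse (ennreal (w x))) *
    Y_average (associate_space Y) B (\<lambda>x. ennreal \<bar>f x * w x\<bar>)"
proof -
  interpret banach_function_space Y by fact
  \<comment> \<open>With this choice the Jacobian of the dilation is \<open>vol B\<close> and
    cancels the normalisation of the average.\<close>
  define \<delta> where "\<delta> = vol B powr (1 / real CARD('n))"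
  have \<delta>: "0 < \<delta>" "\<delta> ^ CARD('n) = vol B"
    using B by (auto simp: \<delta>_def powr_powr simp flip: powr_realpow)
  have [measurable]: "B \<in> sets lebesgue" "w \<in> borel_measurable lebesgue" and w0: "\<And>x. 0 \<le> w x"
    using B w by (auto simp: weight_def)
  let ?F = "dilate \<delta> (\<lambda>x. inverse (ennreal (w x)) * indicator B x)"
  let ?G = "dilate \<delta> (\<lambda>x. ennreal \<bar>f x * w x\<bar> * indicator B x)"
  let ?H = "dilate \<delta> (\<lambda>x. ennreal \<bar>f x\<bar> * indicator B x)"
  have "AE x in lebesgue. ?F x < \<infinity>"
    using fin by (intro AE_finite) (auto simp: Y_average_def \<delta>_def)
  then have "AE x in lebesgue. ?H x = ?F x * ?G x"
  proof eventually_elim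
    case (elim x)
    show ?case
    proof (cases "\<delta> *\<^sub>R x \<in> B")
      case True
      \<comment> \<open>A zero of \<open>w\<close> at this point of \<open>B\<close> would give
        \<open>?F\<close> the value \<open>\<infinity>\<close>.\<close>
      then have "0 < w (\<delta> *\<^sub>R x)"
        using elim w0[of "\<delta> *\<^sub>R x"] by (cases "w (\<delta> *\<^sub>R x) = 0") (auto simp: dilate_def)
      with True show ?thesis
        by (simp add: dilate_def inverse_ennreal abs_mult flip: ennreal_mult)
    qed (simp add: dilate_def)
  qed
  then have "(\<integral>\<^sup>+x. ?H x \<partial>lebesgue) = (\<integral>\<^sup>+x. ?F x * ?G x \<partial>lebesgue)"
    by (rule nn_integral_cong_AE)
  also have "\<dots> \<le> Y ?F * associate_space Y ?G"
    using fin by (intro holder) (auto simp: Y_average_def \<delta>_def)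
  finally have "(\<integral>\<^sup>+x. ?H x \<partial>lebesgue) \<le> Y ?F * associate_space Y ?G" .
  moreover have "average B f = (\<integral>\<^sup>+x. ?H x \<partial>lebesgue)"
    using B unfolding average_def
    by (subst nn_integral_dilate[OF _ \<delta>(1)]) (auto simp: \<delta>(2) mult.commute[of "ennreal (vol B)"] mult_divide_eq_ennreal)
  ultimately show ?thesis
    by (simp add: Y_average_def \<delta>_def)
qed

section \<open>Estimates over the selected sets\<close>

text \<open>By disjointness at most one summand is nonzero at \<open>x\<close>.\<close>

lemma sum_disjoint_indicator_le:
  fixes a :: "'b \<Rightarrow> ennreal"
  assumes S: "finite S" and E: "disjoint_family_on E S" and le: "\<And>B. B \<in> S \<Longrightarrow> x \<in> E B \<Longrightarrow> a B \<le> M"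
  shows "(\<Sum>B\<in>S. a B * indicator (E B) x) \<le> M"
proof (cases "\<exists>X\<in>S. x \<in> E X")
  case True
  then obtain X where X: "X \<in> S" "x \<in> E X" by blast
  have "indicator (E B) x = (0 :: ennreal)" if "B \<in> S - {X}" for B
    using disjoint_family_onD[OF E, of B X] X that by (auto split: split_indicator)
  then have "(\<Sum>B\<in>S - {X}. a B * indicator (E B) x) = 0"
    by (intro sum.neutral ballI) simp
  then have "(\<Sum>B\<in>S. a B * indicator (E B) x) = a X"
    using sum.remove[OF S X(1), of "\<lambda>B. a B * indicator (E B) x"] X(2) by simp
  then show ?thesis using le[OF X] by simp
next
  case False
  then have "(\<Sum>B\<in>S. a B * indicator (E B) x) = 0"
    by (intro sum.neutral ballI) (simp add: indicator_def)
  then show ?thesis by simp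
qed

lemma wLp_norm_mult_weight:
  assumes "weight w" "0 < r"
  shows "wLp_norm r (\<lambda>x. 1) (\<lambda>x. ennreal \<bar>f x * w x\<bar>) = wLp_norm r (\<lambda>x. w x powr r) (\<lambda>x. ennreal \<bar>f x\<bar>)"
proof -
  have "epowr (ennreal \<bar>f x * w x\<bar>) r = epowr (ennreal \<bar>f x\<bar>) r * ennreal (w x powr r)" for x
    using assms by (simp add: epowr_ennreal weight_def abs_mult powr_mult flip: ennreal_mult)
  then show ?thesis by (simp add: wLp_norm_def)
qed

text \<open>The volume of \<open>B\<close> is at most \<open>1 / (1 - \<gamma>)\<close> times that
  of \<open>E B\<close>, and on \<open>E B\<close> the supremum is at least \<open>P B\<close>.
  Disjointness lets all contributions fit under one integral.\<close>

lemma sum_vol_le_nn_integral: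
  fixes \<B> :: "(real ^ 'n) set set" and P :: "(real ^ 'n) set \<Rightarrow> ennreal"
  assumes \<B>: "basis \<B>" and S: "finite S" "S \<subseteq> \<B>" and p: "0 < p" and \<gamma>: "0 < \<gamma>" "\<gamma> < 1"
    and E: "disjoint_family_on E S"
      "\<And>B. B \<in> S \<Longrightarrow> E B \<in> sets lebesgue \<and> E B \<subseteq> B \<and> (1 - \<gamma>) * vol B \<le> vol (E B)"
  shows "(\<Sum>B\<in>S. ennreal (vol B) * epowr (P B) p) \<le>
    ennreal (1 / (1 - \<gamma>)) * (\<integral>\<^sup>+x. epowr (SUP B\<in>{B\<in>\<B>. x \<in> B}. P B) p \<partial>lebesgue)"
proof -
  note B = basisD[OF \<B> subsetD[OF S(2)]]
  have "ennreal (vol B) * epowr (P B) p \<le> ennreal (1 / (1 - \<gamma>)) * (epowr (P B) p * emeasure lebesgue (E B))"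
    if "B \<in> S" for B
  proof -
    have "emeasure lebesgue (E B) \<noteq> top"
      using B(3)[OF that] emeasure_mono[of "E B" B lebesgue] B(4)[OF that] E(2)[OF that]
      by (metis infinity_ennreal_def not_le top.not_eq_extremum)
    then have eq: "emeasure lebesgue (E B) = ennreal (vol (E B))"
      by (rule emeasure_eq_ennreal_measure)
    have "vol B \<le> 1 / (1 - \<gamma>) * vol (E B)"
      using E(2)[OF that] \<gamma> by (simp add: field_simps)
    then have "ennreal (vol B) \<le> ennreal (1 / (1 - \<gamma>)) * emeasure lebesgue (E B)"
      using \<gamma> by (simp add: eq ennreal_leI flip: ennreal_mult)
    then have "ennreal (vol B) * epowr (P B) p \<le> ennreal (1 / (1 - \<gamma>)) * emeasure lebesgue (E B) * epowr (P B) p"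
      by (rule mult_right_mono) simp
    then show ?thesis by (simp add: mult_ac)
  qed
  then have "(\<Sum>B\<in>S. ennreal (vol B) * epowr (P B) p) \<le>
      ennreal (1 / (1 - \<gamma>)) * (\<Sum>B\<in>S. epowr (P B) p * emeasure lebesgue (E B))"
    unfolding sum_distrib_left by (rule sum_mono)
  moreover have "(\<Sum>B\<in>S. epowr (P B) p * emeasure lebesgue (E B)) \<le>
      (\<integral>\<^sup>+x. epowr (SUP B\<in>{B\<in>\<B>. x \<in> B}. P B) p \<partial>lebesgue)"
  proof -
    have "(\<Sum>B\<in>S. epowr (P B) p * emeasure lebesgue (E B)) =
        (\<Sum>B\<in>S. \<integral>\<^sup>+x. epowr (P B) p * indicator (E B) x \<partial>lebesgue)"
      using E(2) by (intro sum.cong refl nn_integral_cmult_indicator[symmetric]) blast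
    also have "\<dots> = (\<integral>\<^sup>+x. (\<Sum>B\<in>S. epowr (P B) p * indicator (E B) x) \<partial>lebesgue)"
    proof (rule nn_integral_sum[symmetric])
      fix B assume "B \<in> S"
      then have [measurable]: "E B \<in> sets lebesgue" using E(2) by blast
      show "(\<lambda>x. epowr (P B) p * indicator (E B) x) \<in> borel_measurable lebesgue" by measurable
    qed
    also have "\<dots> \<le> (\<integral>\<^sup>+x. epowr (SUP B\<in>{B\<in>\<B>. x \<in> B}. P B) p \<partial>lebesgue)"
    proof (rule nn_integral_mono)
      fix x
      have "epowr (P B) p \<le> epowr (SUP B\<in>{B\<in>\<B>. x \<in> B}. P B) p" if "B \<in> S" "x \<in> E B" for B
      proof (rule epowr_mono)
        have "B \<in> {B\<in>\<B>. x \<in> B}" using E(2) S(2) that by blast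
        then show "P B \<le> (SUP B\<in>{B\<in>\<B>. x \<in> B}. P B)" by (rule SUP_upper)
      qed (use p in simp)
      then show "(\<Sum>B\<in>S. epowr (P B) p * indicator (E B) x) \<le> epowr (SUP B\<in>{B\<in>\<B>. x \<in> B}. P B) p"
        by (rule sum_disjoint_indicator_le[OF S(1) E(1)])
    qed
    finally show ?thesis .
  qed
  ultimately show ?thesis
    by (rule order_trans[OF _ mult_left_mono]) simp
qed

text \<open>If \<open>wmeasure \<mu> B = 0\<close>, then the testing condition says nothing, since \<open>0 * \<infinity> = 0\<close>, but the
  left-hand side vanishes as well.\<close>

lemma testing_estimate:
  fixes \<B> :: "(real ^ 'n) set set" and Y :: "nat \<Rightarrow> (real ^ 'n \<Rightarrow> ennreal) \<Rightarrow> ennreal"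
  assumes \<B>: "basis \<B>" "B \<in> \<B>" and p: "0 < p" "0 < q"
    and Y: "\<And>i. i \<in> {1..m} \<Longrightarrow> banach_function_space (Y i)"
    and w: "\<And>i. i \<in> {1..m} \<Longrightarrow> weight (w i)"
    and f: "\<And>i. i \<in> {1..m} \<Longrightarrow> f i \<in> borel_measurable lebesgue"
    and \<phi>: "0 < \<phi> (vol B)"
    and K: "ennreal (\<phi> (vol B) * vol B powr (1 / q - 1 / p)) * epowr (wmeasure \<mu> B / ennreal (vol B)) (1 / q)
        * (\<Prod>i=1..m. Y_average (Y i) B (\<lambda>x. inverse (ennreal (w i x)))) \<le> K" "K < \<infinity>"
  shows "epowr (ennreal (\<phi> (vol B)) * (\<Prod>i=1..m. average B (f i))) q * wmeasure \<mu> B \<le>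
    epowr K q * epowr (ennreal (vol B) *
      epowr (\<Prod>i=1..m. Y_average (associate_space (Y i)) B (\<lambda>x. ennreal \<bar>f i x * w i x\<bar>)) p) (q / p)"
proof (cases "wmeasure \<mu> B = 0")
  case False
  note B = basisD[OF \<B>]
  let ?R = "\<lambda>i. Y_average (Y i) B (\<lambda>x. inverse (ennreal (w i x)))"
  let ?Q = "\<lambda>i. Y_average (associate_space (Y i)) B (\<lambda>x. ennreal \<bar>f i x * w i x\<bar>)"
  let ?W = "wmeasure \<mu> B" let ?V = "ennreal (vol B)"
  let ?L = "epowr (?W / ?V) (1 / q)"
  have V: "?V \<noteq> 0" "?V \<noteq> top" using B(5) by auto
  have R0: "?R i \<noteq> 0" if "i \<in> {1..m}" for i
    using Y[OF that] B w[OF that] by (intro Y_average_pos) (auto simp: weight_def)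
  \<comment> \<open>The factor in front of the product is nonzero, so an infinite product would
    contradict the finite bound \<open>K\<close>.\<close>
  have "ennreal (\<phi> (vol B) * vol B powr (1 / q - 1 / p)) * ?L \<noteq> 0"
    using B(5) \<phi> False V by (simp add: ennreal_divide_eq_0_iff)
  then have "(\<Prod>i=1..m. ?R i) \<noteq> top"
    using K by (auto simp: ennreal_mult_top top_unique)
  then have Rfin: "?R i < \<infinity>" if "i \<in> {1..m}" for i
    using R0 that by (auto simp: ennreal_prod_eq_top less_top)
  have "(\<Prod>i=1..m. average B (f i)) \<le> (\<Prod>i=1..m. ?R i * ?Q i)"
    using Y B(4,5) w f Rfin by (intro prod_mono_ennreal average_le_Y_averages)
  then have avg: "(\<Prod>i=1..m. average B (f i)) \<le> (\<Prod>i=1..m. ?R i) * (\<Prod>i=1..m. ?Q i)"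
    by (simp add: prod.distrib)
  \<comment> \<open>The weighted measure is volume times mean, and the power \<open>1 / q\<close> of
    the volume splits into \<open>1 / q - 1 / p\<close> and \<open>1 / p\<close>. The first belongs
    to the testing quantity, the second to the unweighted estimate.\<close>
  have "?W = ?V * (?W / ?V)"
    using V by (simp add: ennreal_times_divide mult.commute[of ?V] mult_divide_eq_ennreal)
  then have "epowr ?W (1 / q) = epowr ?V (1 / q) * ?L"
    by (metis epowr_mult)
  also have "epowr ?V (1 / q) = ennreal (vol B powr (1 / q - 1 / p)) * epowr ?V (1 / p)"
    by (simp add: epowr_ennreal flip: ennreal_mult powr_add)
  finally have W: "epowr ?W (1 / q) = ennreal (vol B powr (1 / q - 1 / p)) * epowr ?V (1 / p) * ?L" .
  have "ennreal (\<phi> (vol B)) * (\<Prod>i=1..m. average B (f i)) * epowr ?W (1 / q) \<le>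
      ennreal (\<phi> (vol B)) * ((\<Prod>i=1..m. ?R i) * (\<Prod>i=1..m. ?Q i)) * epowr ?W (1 / q)"
    by (intro mult_right_mono mult_left_mono avg) auto
  also have "\<dots> = (ennreal (\<phi> (vol B) * vol B powr (1 / q - 1 / p)) * ?L * (\<Prod>i=1..m. ?R i)) *
      (epowr ?V (1 / p) * (\<Prod>i=1..m. ?Q i))"
    using \<phi> by (simp add: W ennreal_mult mult_ac)
  also have "\<dots> \<le> K * (epowr ?V (1 / p) * (\<Prod>i=1..m. ?Q i))"
    by (intro mult_right_mono K) auto
  finally have "epowr (ennreal (\<phi> (vol B)) * (\<Prod>i=1..m. average B (f i)) * epowr ?W (1 / q)) q \<le>
      epowr (K * (epowr ?V (1 / p) * (\<Prod>i=1..m. ?Q i))) q"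
    using p by (intro epowr_mono) auto
  then show ?thesis
    using p by (simp add: epowr_mult epowr_epowr)
qed simp

section \<open>The weighted norm inequality for the multilinear maximal operator\<close>

theorem theorem2p8:
  fixes m :: nat
    and ps :: "nat \<Rightarrow> real" and p q \<gamma> :: real
    and \<phi> :: "real \<Rightarrow> real"
    and \<B> :: "(real ^ 'n) set set"
    and Y :: "nat \<Rightarrow> (real ^ 'n \<Rightarrow> ennreal) \<Rightarrow> ennreal"
    and w :: "nat \<Rightarrow> real ^ 'n \<Rightarrow> real" and v :: "real ^ 'n \<Rightarrow> real"
  assumes "1 \<le> m"
    and "\<And>i. i \<in> {1..m} \<Longrightarrow> 1 < ps i"
    and "1 / p = (\<Sum>i=1..m. 1 / ps i)"
    and "0 < p" and "p \<le> q"
    and "\<And>t. 0 < t \<Longrightarrow> 0 < \<phi> t"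
    and "essentially_nondecreasing \<phi>"
    and "((\<lambda>t. \<phi> t / t) \<longlongrightarrow> 0) at_top"
    and "basis \<B>"
    and "\<And>i. i \<in> {1..m} \<Longrightarrow> banach_function_space (Y i)"
    and "bounded_multi m ps (\<lambda>i x. 1) p (\<lambda>x. 1) (associate_maximal_op \<B> Y m)"
    and "\<And>i. i \<in> {1..m} \<Longrightarrow> weight (w i)"
    and "weight v"
    and "weight_associated \<B> (\<lambda>x. v x powr q)"
    and "0 < \<gamma>" and "\<gamma> < 1"
    and "tauberian \<B> \<gamma> (\<lambda>x. v x powr q)"
    and "(SUP B\<in>\<B>. ennreal (\<phi> (vol B) * vol B powr (1 / q - 1 / p))
            * epowr (wmeasure (\<lambda>x. v x powr q) B / ennreal (vol B)) (1 / q)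
            * (\<Prod>i=1..m. Y_average (Y i) B (\<lambda>x. inverse (ennreal (w i x))))) < \<infinity>"
  shows "bounded_multi m ps (\<lambda>i x. w i x powr ps i) q (\<lambda>x. v x powr q)
           (multilinear_maximal_op \<B> \<phi> m)"
proof -
  note ps = assms(2) and \<phi> = assms(6) and \<B> = assms(9) and Y = assms(10) and w = assms(12)
    and \<gamma> = assms(15,16)
  have pq: "0 < p" "0 < q" "1 \<le> q / p" using assms(4,5) by auto
  define \<mu> where "\<mu> = (\<lambda>x. v x powr q)"
  have \<mu>: "weight \<mu>" using assms(14) by (simp add: weight_associated_def \<mu>_def)
  then have [measurable]: "\<mu> \<in> borel_measurable lebesgue" by (simp add: weight_def)
  obtain C\<^sub>T where C\<^sub>T: "0 < C\<^sub>T" "\<And>E. E \<in> sets lebesgue \<Longrightarrow>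
      wmeasure \<mu> {x. maximal_op \<B> (indicator E) x > ennreal \<gamma>} \<le> ennreal C\<^sub>T * wmeasure \<mu> E"
    using assms(17) unfolding tauberian_def \<mu>_def by blast
  obtain C\<^sub>Y where C\<^sub>Y: "0 < C\<^sub>Y" "\<And>g. (\<And>i. i \<in> {1..m} \<Longrightarrow> g i \<in> wLp (ps i) (\<lambda>x. 1)) \<Longrightarrow>
      wLp_norm p (\<lambda>x. 1) (associate_maximal_op \<B> Y m g) \<le>
      ennreal C\<^sub>Y * (\<Prod>i=1..m. wLp_norm (ps i) (\<lambda>x. 1) (\<lambda>x. ennreal \<bar>g i x\<bar>))"
    using assms(11) unfolding bounded_multi_def by blast
  define K where "K = (SUP B\<in>\<B>. ennreal (\<phi> (vol B) * vol B powr (1 / q - 1 / p))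
            * epowr (wmeasure \<mu> B / ennreal (vol B)) (1 / q)
            * (\<Prod>i=1..m. Y_average (Y i) B (\<lambda>x. inverse (ennreal (w i x)))))"
  have Kfin: "K < \<infinity>" using assms(18) by (simp add: K_def \<mu>_def)
  \<comment> \<open>The factors come from the Tauberian condition, the testing condition, the
    disjoint parts and the associate maximal operator, in the powers left after taking the
    \<open>q\<close>-th root.\<close>
  define A where "A = epowr (ennreal C\<^sub>T) (1 / q) * K * epowr (ennreal (1 / (1 - \<gamma>))) (1 / p) * ennreal C\<^sub>Y"
  have Afin: "A < top"
    using Kfin C\<^sub>T(1) \<gamma> by (simp add: A_def epowr_ennreal ennreal_mult_less_top)
  have main: "wLp_norm q \<mu> (multilinear_maximal_op \<B> \<phi> m f) \<le>
      A * (\<Prod>i=1..m. wLp_norm (ps i) (\<lambda>x. w i x powr ps i) (\<lambda>x. ennreal \<bar>f i x\<bar>))"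
    if f: "\<And>i. i \<in> {1..m} \<Longrightarrow> f i \<in> wLp (ps i) (\<lambda>x. w i x powr ps i)" for f
  proof -
    \<comment> \<open>Passing to \<open>f i * w i\<close> turns weighted norms into unweighted ones,
      to which the assumed bound applies.\<close>
    define g where "g i x = f i x * w i x" for i x
    define c where "c B = ennreal (\<phi> (vol B)) * (\<Prod>i=1..m. average B (f i))" for B
    define P where "P B = (\<Prod>i=1..m. Y_average (associate_space (Y i)) B (\<lambda>x. ennreal \<bar>g i x\<bar>))" for B
    define J where "J = (\<integral>\<^sup>+x. epowr (associate_maximal_op \<B> Y m g x) p \<partial>lebesgue)"
    have fm: "f i \<in> borel_measurable lebesgue" if "i \<in> {1..m}" for i
      using f[OF that] by (simp add: wLp_def)
    have norm_g: "wLp_norm (ps i) (\<lambda>x. 1) (\<lambda>x. ennreal \<bar>g i x\<bar>) =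
        wLp_norm (ps i) (\<lambda>x. w i x powr ps i) (\<lambda>x. ennreal \<bar>f i x\<bar>)" if "i \<in> {1..m}" for i
      unfolding g_def using w[OF that] ps[OF that] by (intro wLp_norm_mult_weight) auto
    have "g i \<in> wLp (ps i) (\<lambda>x. 1)" if i: "i \<in> {1..m}" for i
    proof -
      have "g i \<in> borel_measurable lebesgue"
        unfolding g_def using fm[OF i] w[OF i] by (auto simp: weight_def)
      then show ?thesis using f[OF i] norm_g[OF i] by (simp add: wLp_def)
    qed
    then have J: "epowr J (1 / p) \<le> ennreal C\<^sub>Y *
        (\<Prod>i=1..m. wLp_norm (ps i) (\<lambda>x. w i x powr ps i) (\<lambda>x. ennreal \<bar>f i x\<bar>))"
      using C\<^sub>Y(2)[of g] norm_g by (simp add: wLp_norm_def J_def)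
    have key: "epowr (c B) q * wmeasure \<mu> B \<le> epowr K q * epowr (ennreal (vol B) * epowr (P B) p) (q / p)"
      if "B \<in> \<B>" for B
      unfolding c_def P_def g_def
    proof (rule testing_estimate[OF \<B> that pq(1,2)])
      show "0 < \<phi> (vol B)" using \<phi> basisD(5)[OF \<B> that] .
      show "ennreal (\<phi> (vol B) * vol B powr (1 / q - 1 / p)) * epowr (wmeasure \<mu> B / ennreal (vol B)) (1 / q)
          * (\<Prod>i=1..m. Y_average (Y i) B (\<lambda>x. inverse (ennreal (w i x)))) \<le> K"
        unfolding K_def using that by (rule SUP_upper)
    qed (fact Y w fm Kfin)+
    \<comment> \<open>The bound is the same for every finite \<open>F\<close>, as the passage to all
      of \<open>\<B>\<close> requires.\<close>
    have finite_case: "(\<integral>\<^sup>+x. (SUP B\<in>{B\<in>F. x \<in> B}. epowr (c B) q) * ennreal (\<mu> x) \<partial>lebesgue) \<le>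
        ennreal C\<^sub>T * (epowr K q * epowr (ennreal (1 / (1 - \<gamma>)) * J) (q / p))"
      if F: "finite F" "F \<subseteq> \<B>" for F
    proof -
      obtain S E where S: "S \<subseteq> F" and E: "disjoint_family_on E S"
          "\<And>B. B \<in> S \<Longrightarrow> E B \<in> sets lebesgue \<and> E B \<subseteq> B \<and> (1 - \<gamma>) * vol B \<le> vol (E B)"
        and le: "(\<integral>\<^sup>+x. (SUP B\<in>{B\<in>F. x \<in> B}. epowr (c B) q) * ennreal (\<mu> x) \<partial>lebesgue)
          \<le> ennreal C\<^sub>T * (\<Sum>B\<in>S. epowr (c B) q * wmeasure \<mu> B)"
        by (rule covering_selection[OF \<B> \<gamma> \<mu> C\<^sub>T(2) F, of "\<lambda>B. epowr (c B) q"]) blast+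
      have S': "finite S" "S \<subseteq> \<B>" using S F finite_subset by auto
      have "(\<Sum>B\<in>S. epowr (c B) q * wmeasure \<mu> B) \<le>
          (\<Sum>B\<in>S. epowr K q * epowr (ennreal (vol B) * epowr (P B) p) (q / p))"
        using S' by (intro sum_mono key) auto
      \<comment> \<open>Here \<open>p \<le> q\<close> enters: powers with exponent
        \<open>q / p \<ge> 1\<close> are superadditive.\<close>
      also have "\<dots> \<le> epowr K q * epowr (\<Sum>B\<in>S. ennreal (vol B) * epowr (P B) p) (q / p)"
        unfolding sum_distrib_left[symmetric] by (rule mult_left_mono[OF sum_epowr_le[OF pq(3)]]) simp
      also have "\<dots> \<le> epowr K q * epowr (ennreal (1 / (1 - \<gamma>)) * J) (q / p)"
      proof (intro mult_left_mono epowr_mono)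
        show "(\<Sum>B\<in>S. ennreal (vol B) * epowr (P B) p) \<le> ennreal (1 / (1 - \<gamma>)) * J"
          unfolding J_def associate_maximal_op_def P_def[symmetric]
          by (rule sum_vol_le_nn_integral[OF \<B> S' pq(1) \<gamma> E])
      qed (use pq in simp_all)
      finally have "ennreal C\<^sub>T * (\<Sum>B\<in>S. epowr (c B) q * wmeasure \<mu> B) \<le>
          ennreal C\<^sub>T * (epowr K q * epowr (ennreal (1 / (1 - \<gamma>)) * J) (q / p))"
        by (rule mult_left_mono) simp
      with le show ?thesis by (rule order_trans)
    qed
    have "(\<integral>\<^sup>+x. epowr (multilinear_maximal_op \<B> \<phi> m f x) q * ennreal (\<mu> x) \<partial>lebesgue) \<le>
        ennreal C\<^sub>T * (epowr K q * epowr (ennreal (1 / (1 - \<gamma>)) * J) (q / p))"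
      \<comment> \<open>The power \<open>q\<close> moves inside the supremum, so the reduction to
        finite families applies to \<open>epowr (c B) q\<close>.\<close>
      unfolding multilinear_maximal_op_def c_def[symmetric] epowr_SUP[OF pq(2)]
      by (rule nn_integral_SUP_le_finite[OF basisD(1)[OF \<B>] _ finite_case]) simp_all
    then have "wLp_norm q \<mu> (multilinear_maximal_op \<B> \<phi> m f) \<le>
        epowr (ennreal C\<^sub>T * (epowr K q * epowr (ennreal (1 / (1 - \<gamma>)) * J) (q / p))) (1 / q)"
      unfolding wLp_norm_def using pq by (intro epowr_mono) auto
    \<comment> \<open>The exponents \<open>q / p\<close> and \<open>1 / q\<close> multiply to
      \<open>1 / p\<close>, which turns \<open>J\<close> into an unweighted norm.\<close>
    also have "\<dots> = epowr (ennreal C\<^sub>T) (1 / q) * K * epowr (ennreal (1 / (1 - \<gamma>))) (1 / p) * epowr J (1 / p)"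
      using pq by (simp add: epowr_mult epowr_epowr mult_ac)
    also have "\<dots> \<le> epowr (ennreal C\<^sub>T) (1 / q) * K * epowr (ennreal (1 / (1 - \<gamma>))) (1 / p) *
        (ennreal C\<^sub>Y * (\<Prod>i=1..m. wLp_norm (ps i) (\<lambda>x. w i x powr ps i) (\<lambda>x. ennreal \<bar>f i x\<bar>)))"
      by (intro mult_left_mono J) auto
    finally show ?thesis
      by (simp add: A_def mult.assoc)
  qed
  \<comment> \<open>\<open>A\<close> may be 0, but boundedness asks for a positive real constant;
    adding 1 provides one.\<close>
  have "A \<le> ennreal (enn2real A + 1)"
    using Afin by (cases A) (auto intro: ennreal_leI)
  then have "wLp_norm q \<mu> (multilinear_maximal_op \<B> \<phi> m f) \<le> ennreal (enn2real A + 1) *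
      (\<Prod>i=1..m. wLp_norm (ps i) (\<lambda>x. w i x powr ps i) (\<lambda>x. ennreal \<bar>f i x\<bar>))"
    if "\<And>i. i \<in> {1..m} \<Longrightarrow> f i \<in> wLp (ps i) (\<lambda>x. w i x powr ps i)" for f
    using order_trans[OF main[OF that] mult_right_mono] by auto
  moreover have "0 < enn2real A + 1"
    by (simp add: add_nonneg_pos)
  ultimately show ?thesis
    unfolding bounded_multi_def \<mu>_def by (intro exI[of _ "enn2real A + 1"]) auto
qed

end
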